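(* Let $\alpha,\beta\in\Gamma$ be given, let the Weak Atkinson condition hold, and let $f$ be an arbitrary sequence $\{f_k\}_{k=0}^{N+1}$ in $\mathbb C^{2n}$. Let $\hat z=\{\hat z_k\}_{k=0}^{N+1}$ be a solution of the boundary value problem $$z_k=\mathcal S_k z_{k+1}-\mathcal J\Psi_k f_k,\quad k\in\mathcal I_{\mathbb Z},\qquad \alpha z_0=0=\beta z_{N+1}.$$ Let $\lambda_1<\dots<\lambda_p$ be the distinct eigenvalues of $(\mathrm S_\lambda)$, and for each $j$ let $z^{[1]}(\lambda_j),\dots,z^{[r_j]}(\lambda_j)$ be the members corresponding to $\lambda_j$ of the finite orthonormal set of eigenfunctions. Then the equivalence class $[\hat z]\in\tilde\ell^2_\Psi$ has the representative $$\sum_{j=1}^p\sum_{\ell=1}^{r_j}c_j^{[\ell]}z^{[\ell]}(\lambda_j),\qquad c_j^{[\ell]}:=\sum_{k\in\mathcal I_{\mathbb Z}}z_k^{[\ell]*}(\lambda_j)\Psi_k\hat z_k,$$ i.e. $$\Big\|\hat z-\sum_{j=1}^p\sum_{\ell=1}^{r_j}c_j^{[\ell]}z^{[\ell]}(\lambda_j)\Big\|_\Psi=0,$$ and consequently Parseval's identity holds: $$\|\hat z\|_\Psi^2=\sum_{j=1}^p\sum_{\ell=1}^{r_j}|c_j^{[\ell]}|^2 .$$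
   Context: Setting: $n\in\mathbb N$, $N\in\{0,1,2,\dots\}$, $\mathcal I_{\mathbb Z}=[0,N]\cap\mathbb Z$, $\mathcal I_{\mathbb Z}^+=[0,N+1]\cap\mathbb Z$, $\mathcal J=\begin{pmatrix}0&-I_n\\ I_n&0\end{pmatrix}$. For all $k\in\mathcal I_{\mathbb Z}$, $\mathcal S_k,\Psi_k\in\mathbb C^{2n\times2n}$ satisfy $\mathcal S_k^*\mathcal J\mathcal S_k=\mathcal J$, $\Psi_k^*=\Psi_k$, $\Psi_k^*\mathcal J\Psi_k=0$, $\Psi_k\ge0$; put $\mathcal V_k=-\mathcal J\Psi_k\mathcal S_k$ and $\mathbb S_k(\lambda)=\mathcal S_k+\lambda\mathcal V_k$ (an invertible matrix for each $\lambda\in\mathbb C$). System $(\mathrm S_\lambda)$: $z_k=\mathbb S_k(\lambda)z_{k+1}$, $k\in\mathcal I_{\mathbb Z}$, for sequences on $\mathcal I_{\mathbb Z}^+$. $\Gamma=\{\alpha\in\mathbb C^{n\times 2n}:\alpha\alpha^*=I_n,\ \alpha\mathcal J\alpha^*=0\}$. A number $\lambda\in\mathbb C$ is an eigenvalue, with eigenfunction $z\not\equiv0$, if $z$ solves $(\mathrm S_\lambda)$ and $\alpha z_0=0=\beta z_{N+1}$; $\operatorname{Eigen}(\lambda)$ is the space of all solutions of this problem. $\langle z,u\rangle_\Psi=\sum_{k\in\mathcal I_{\mathbb Z}}z_k^*\Psi_ku_k$, $\|z\|_\Psi=\sqrt{\langle z,z\rangle_\Psi}$; $\tilde\ell^2_\Psi$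 is the space of sequences on $\mathcal I_{\mathbb Z}^+$ with values in $\mathbb C^{2n}$ modulo $\{z:\|z\|_\Psi=0\}$. $\tilde Z(\lambda)$ is the $2n\times n$ matrix solution of $(\mathrm S_\lambda)$ with $\tilde Z_0(\lambda)=-\mathcal J\alpha^*$. Weak Atkinson condition (for $\alpha$): there is $\lambda\in\mathbb C$ such that $\sum_{k=0}^Nz_k^*\Psi_kz_k>0$ for every $z=\tilde Z(\lambda)\eta$, $0\neq\eta\in\mathbb C^n$. Under this condition there are only finitely many eigenvalues, all real. With $r_j=\dim\operatorname{Eigen}(\lambda_j)$, $z^{[1]}(\lambda_j),\dots,z^{[r_j]}(\lambda_j)$ is a basis of $\operatorname{Eigen}(\lambda_j)$ orthonormal with respect to $\langle\cdot,\cdot\rangle_\Psi$; eigenfunctions belonging to different eigenvalues are orthogonal, so the union over $j$ is a finite orthonormal set. *)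

theory Defs
  imports "HOL-Analysis.Analysis" "HOL-Library.Function_Algebras"
begin

text \<open>
  The dimension n is the cardinality of the index type \<open>'n\<close>, so n is positive, and the 2n
  coordinates are indexed by the sum type \<open>'n + 'n\<close>, whose two summands are the two blocks.
  The order on \<^typ>\<open>complex\<close> is that of \<^theory>\<open>HOL-Library.Complex_Order\<close>:
  \<open>0 \<le> c\<close> and \<open>0 < c\<close> include the assertion that \<open>c\<close> is real.
\<close>

type_synonym 'n vec2 = "complex ^ ('n + 'n)"
type_synonym 'n mat2 = "complex ^ ('n + 'n) ^ ('n + 'n)"
type_synonym 'n sequ = "nat \<Rightarrow> complex ^ ('n + 'n)"

definition adj :: "complex ^ 'b::finite ^ 'a::finite \<Rightarrow> complex ^ 'a ^ 'b"
  where "adj A = map_matrix cnj (transpose A)"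

text \<open>The number \<open>v\<^sup>* w\<close>, conjugate-linear in the first argument.\<close>

definition cdot :: "complex ^ 'a::finite \<Rightarrow> complex ^ 'a \<Rightarrow> complex"
  where "cdot v w = (\<Sum>i\<in>UNIV. cnj (v $ i) * w $ i)"

definition psd :: "complex ^ 'a::finite ^ 'a \<Rightarrow> bool"
  where "psd A \<longleftrightarrow> adj A = A \<and> (\<forall>v. 0 \<le> cdot v (A *v v))"

definition J :: "'n::finite mat2"
  where "J = (\<chi> i j. case (i, j) of
      (Inl a, Inr b) \<Rightarrow> (if a = b then - 1 else 0)
    | (Inr a, Inl b) \<Rightarrow> (if a = b then 1 else 0)
    | _ \<Rightarrow> 0)"

definition Gamma_bc :: "(complex ^ ('n + 'n) ^ 'n::finite) set"
  where "Gamma_bc = {\<alpha>. \<alpha> ** adj \<alpha> = mat 1 \<and> \<alpha> ** J ** adj \<alpha> = 0}"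

definition coefficients_ok :: "nat \<Rightarrow> (nat \<Rightarrow> 'n::finite mat2) \<Rightarrow> (nat \<Rightarrow> 'n mat2) \<Rightarrow> bool"
  where "coefficients_ok N S \<Psi> \<longleftrightarrow>
    (\<forall>k\<le>N. adj (S k) ** J ** S k = J \<and> adj (\<Psi> k) = \<Psi> k
          \<and> adj (\<Psi> k) ** J ** \<Psi> k = 0 \<and> psd (\<Psi> k))"

definition V_coeff :: "(nat \<Rightarrow> 'n::finite mat2) \<Rightarrow> (nat \<Rightarrow> 'n mat2) \<Rightarrow> nat \<Rightarrow> 'n mat2"
  where "V_coeff S \<Psi> k = - (J ** \<Psi> k ** S k)"

definition SS :: "(nat \<Rightarrow> 'n::finite mat2) \<Rightarrow> (nat \<Rightarrow> 'n mat2) \<Rightarrow> complex \<Rightarrow> nat \<Rightarrow> 'n mat2"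
  where "SS S \<Psi> \<mu> k = S k + map_matrix ((*) \<mu>) (V_coeff S \<Psi> k)"

text \<open>
  Sequences on the indices \<open>0, \<dots>, N + 1\<close>, encoded as total functions vanishing at all other
  indices, so that linear independence, spans and dimensions of sets of sequences see exactly the
  entries with index at most \<open>N + 1\<close>.
\<close>

definition seqs :: "nat \<Rightarrow> 'n::finite sequ set"
  where "seqs N = {z. \<forall>k > N + 1. z k = 0}"

definition seq_scale :: "complex \<Rightarrow> 'n::finite sequ \<Rightarrow> 'n sequ"
  where "seq_scale c z = (\<lambda>k. c *s z k)"

interpretation seq: vector_space "seq_scale :: complex \<Rightarrow> 'n::finite sequ \<Rightarrow> 'n sequ"
  by unfold_locales
    (auto simp: seq_scale_def fun_eq_iff vec_eq_iff algebra_simps)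

definition solves :: "nat \<Rightarrow> (nat \<Rightarrow> 'n::finite mat2) \<Rightarrow> (nat \<Rightarrow> 'n mat2) \<Rightarrow> complex \<Rightarrow> 'n sequ \<Rightarrow> bool"
  where "solves N S \<Psi> \<mu> z \<longleftrightarrow> (\<forall>k\<le>N. z k = SS S \<Psi> \<mu> k *v z (k + 1))"

definition Eigen :: "nat \<Rightarrow> (nat \<Rightarrow> 'n::finite mat2) \<Rightarrow> (nat \<Rightarrow> 'n mat2) \<Rightarrow>
    complex ^ ('n + 'n) ^ 'n \<Rightarrow> complex ^ ('n + 'n) ^ 'n \<Rightarrow> complex \<Rightarrow> 'n sequ set"
  where "Eigen N S \<Psi> \<alpha> \<beta> \<mu> =
    {z \<in> seqs N. solves N S \<Psi> \<mu> z \<and> \<alpha> *v z 0 = 0 \<and> \<beta> *v z (N + 1) = 0}"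

definition eigenvalues :: "nat \<Rightarrow> (nat \<Rightarrow> 'n::finite mat2) \<Rightarrow> (nat \<Rightarrow> 'n mat2) \<Rightarrow>
    complex ^ ('n + 'n) ^ 'n \<Rightarrow> complex ^ ('n + 'n) ^ 'n \<Rightarrow> complex set"
  where "eigenvalues N S \<Psi> \<alpha> \<beta> = {\<mu>. \<exists>z \<in> Eigen N S \<Psi> \<alpha> \<beta> \<mu>. z \<noteq> 0}"

definition psi_inner :: "nat \<Rightarrow> (nat \<Rightarrow> 'n::finite mat2) \<Rightarrow> 'n sequ \<Rightarrow> 'n sequ \<Rightarrow> complex"
  where "psi_inner N \<Psi> z u = (\<Sum>k\<le>N. cdot (z k) (\<Psi> k *v u k))"

text \<open>For positive semidefinite weights the number under the root is real and nonnegative.\<close>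

definition psi_norm :: "nat \<Rightarrow> (nat \<Rightarrow> 'n::finite mat2) \<Rightarrow> 'n sequ \<Rightarrow> real"
  where "psi_norm N \<Psi> z = sqrt (Re (psi_inner N \<Psi> z z))"

definition psi_equiv :: "nat \<Rightarrow> (nat \<Rightarrow> 'n::finite mat2) \<Rightarrow> ('n sequ \<times> 'n sequ) set"
  where "psi_equiv N \<Psi> = {(z, u). z \<in> seqs N \<and> u \<in> seqs N \<and> psi_norm N \<Psi> (z - u) = 0}"

definition ell2 :: "nat \<Rightarrow> (nat \<Rightarrow> 'n::finite mat2) \<Rightarrow> 'n sequ set set"
  where "ell2 N \<Psi> = seqs N // psi_equiv N \<Psi>"

text \<open>
  The matrix solution with initial value \<open>- J \<alpha>\<^sup>*\<close>; the recursion determines its entries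
  with index at most \<open>N + 1\<close>, because every \<^const>\<open>SS\<close> matrix is invertible.
\<close>

definition is_Z_tilde :: "nat \<Rightarrow> (nat \<Rightarrow> 'n::finite mat2) \<Rightarrow> (nat \<Rightarrow> 'n mat2) \<Rightarrow>
    complex ^ ('n + 'n) ^ 'n \<Rightarrow> complex \<Rightarrow> (nat \<Rightarrow> complex ^ 'n ^ ('n + 'n)) \<Rightarrow> bool"
  where "is_Z_tilde N S \<Psi> \<alpha> \<mu> Z \<longleftrightarrow>
    Z 0 = - (J ** adj \<alpha>) \<and> (\<forall>k\<le>N. Z k = SS S \<Psi> \<mu> k ** Z (k + 1))"

definition weak_Atkinson :: "nat \<Rightarrow> (nat \<Rightarrow> 'n::finite mat2) \<Rightarrow> (nat \<Rightarrow> 'n mat2) \<Rightarrow>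
    complex ^ ('n + 'n) ^ 'n \<Rightarrow> bool"
  where "weak_Atkinson N S \<Psi> \<alpha> \<longleftrightarrow>
    (\<exists>\<mu> Z. is_Z_tilde N S \<Psi> \<alpha> \<mu> Z \<and>
      (\<forall>\<eta>. \<eta> \<noteq> 0 \<longrightarrow> 0 < (\<Sum>k\<le>N. cdot (Z k *v \<eta>) (\<Psi> k *v (Z k *v \<eta>)))))"

definition orthonormal_basis :: "nat \<Rightarrow> (nat \<Rightarrow> 'n::finite mat2) \<Rightarrow> 'n sequ set \<Rightarrow> nat \<Rightarrow>
    (nat \<Rightarrow> 'n sequ) \<Rightarrow> bool"
  where "orthonormal_basis N \<Psi> E r z \<longleftrightarrow>
    seq.independent (z ` {1..r}) \<and> seq.span (z ` {1..r}) = E \<and>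
    (\<forall>l\<in>{1..r}. \<forall>m\<in>{1..r}. psi_inner N \<Psi> (z l) (z m) = (if l = m then 1 else 0))"

definition solves_bvp :: "nat \<Rightarrow> (nat \<Rightarrow> 'n::finite mat2) \<Rightarrow> (nat \<Rightarrow> 'n mat2) \<Rightarrow>
    complex ^ ('n + 'n) ^ 'n \<Rightarrow> complex ^ ('n + 'n) ^ 'n \<Rightarrow> 'n sequ \<Rightarrow> 'n sequ \<Rightarrow> bool"
  where "solves_bvp N S \<Psi> \<alpha> \<beta> f z \<longleftrightarrow>
    (\<forall>k\<le>N. z k = S k *v z (k + 1) - J *v (\<Psi> k *v f k)) \<and>
    \<alpha> *v z 0 = 0 \<and> \<beta> *v z (N + 1) = 0"

end

theory Submission
  imports Defs "HOL-Computational_Algebra.Fundamental_Theorem_Algebra"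
begin

text \<open>
  The pairs \<open>(z, f)\<close> for which \<open>z\<close> solves the boundary value problem with right-hand side \<open>f\<close> form
  a linear relation, symmetric by the Lagrange identity because \<open>\<alpha>\<close> and \<open>\<beta>\<close> have isotropic kernels.
  The weak Atkinson condition rules out nonzero eigenfunctions of zero seminorm, so eigenvalues are
  real and, by orthogonality in finite dimension, finite in number. Hence the relation has a
  resolvent \<open>R\<close> at some real point \<open>\<mu>\<close>, and \<open>R\<close> preserves the space \<open>K\<close> of those \<open>z\<close> in its domain
  that are orthogonal to all eigenfunctions. If \<open>K\<close> contained an element of nonzero seminorm, then
  \<open>R\<close> would have an eigenvector modulo the null sequences: \<open>R h \<equiv> \<nu> h\<close> with \<open>h \<in> K\<close> not null. For
  \<open>\<nu> \<noteq> 0\<close> this makes \<open>R h\<close> an eigenfunction for \<open>\<mu> + 1 / \<nu>\<close> orthogonal to itself; for \<open>\<nu> = 0\<close> the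
  identity pairs \<open>h\<close> with \<open>R h\<close> and gives \<open>\<langle>h, h\<rangle> = 0\<close>. Both are impossible. Applied to
  \<open>z - \<Sum> c z\<close>, the difference of the solution and its projection, this is the theorem.
\<close>

section \<open>Polynomials in an operator on a finite-dimensional space\<close>

text \<open>If \<open>P\<close> had trivial kernel, the images of the monomials would be infinitely
  many independent vectors inside a finitely generated span.\<close>

lemma (in vector_space) exists_poly_annihilating:
  fixes P :: "'a poly \<Rightarrow> 'b"
  assumes add: "\<And>p q. P (p + q) = P p + P q" and smult: "\<And>c p. P (smult c p) = scale c (P p)"
    and B: "finite B" "range P \<subseteq> span B"
  shows "\<exists>p. p \<noteq> 0 \<and> P p = 0"
proof (rule ccontr)
  assume "\<not> ?thesis"
  then have inj0: "\<And>p. P p = 0 \<Longrightarrow> p = 0" by blast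
  have P0: "P 0 = 0" using smult[of 0 0] by simp
  have diff: "P (p - q) = P p - P q" for p q
    using add[of p "smult (- 1) q"] smult[of "- 1" q] by simp
  have P_sum: "P (sum h I) = (\<Sum>i\<in>I. P (h i))" for h :: "nat \<Rightarrow> 'a poly" and I
    by (induction I rule: infinite_finite_induct) (auto simp: P0 add)
  define b where "b i = P (monom 1 i)" for i
  have P_monom: "P (monom c i) = scale c (b i)" for c i
    using smult[of c "monom 1 i"] by (simp add: smult_monom b_def)
  have inj: "inj b"
  proof
    fix i j assume "b i = b j"
    then have "P (monom 1 i - monom 1 j) = 0"
      by (simp only: b_def diff right_minus_eq)
    then have "monom 1 i - monom 1 j = (0 :: 'a poly)" by (rule inj0)
    then show "i = j" by (simp add: monom_eq_iff')
  qed
  have "independent (range b)"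
  proof
    assume "dependent (range b)"
    then obtain t u v where t: "finite t" "t \<subseteq> range b" "(\<Sum>v\<in>t. scale (u v) v) = 0" "v \<in> t" "u v \<noteq> 0"
      unfolding dependent_explicit by blast
    obtain I where I: "t = b ` I" "finite I"
      using t(1,2) by (metis finite_subset_image)
    define p where "p = (\<Sum>i\<in>I. monom (u (b i)) i)"
    have "P p = (\<Sum>i\<in>I. scale (u (b i)) (b i))"
      unfolding p_def P_sum P_monom ..
    also have "\<dots> = (\<Sum>v\<in>t. scale (u v) v)"
      unfolding I(1) by (subst sum.reindex) (auto intro: inj_on_subset[OF inj])
    finally have "p = 0" using t inj0 by simp
    obtain i where i: "i \<in> I" "v = b i" using t(4) I by auto
    have "coeff p i = u (b i)"
      unfolding p_def coeff_sum using i I by (simp add: sum.delta')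
    with \<open>p = 0\<close> i t(5) show False by simp
  qed
  then have "finite (range b)"
    using independent_span_bound[OF B(1), of "range b"] B(2) by (auto simp: b_def)
  with inj show False using finite_imageD by blast
qed

text \<open>\<open>P p\<close> stands for the vector \<open>p(R) g\<close>, evaluated by Horner's
  scheme. The listed rules characterise it, so powers of \<open>R\<close> never have to be
  handled.\<close>

lemma (in vector_space) exists_polynomial_action:
  fixes R :: "'b \<Rightarrow> 'b" and g :: 'b
  assumes R: "Vector_Spaces.linear scale scale R"
  shows "\<exists>P. (\<forall>p q. P (p + q) = P p + P q) \<and> (\<forall>c p. P (smult c p) = scale c (P p)) \<and>
    (\<forall>a p. P (pCons a p) = scale a g + R (P p)) \<and> P 0 = 0"
proof -
  interpret R: Vector_Spaces.linear scale scale R by (rule R)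
  define P where "P p = fold_coeffs (\<lambda>a x. scale a g + R x) p 0" for p
  have P_0: "P 0 = 0" by (simp add: P_def)
  have P_pCons: "P (pCons a p) = scale a g + R (P p)" for a p
    \<comment> \<open>The zero polynomial has no coefficients to fold over, so
      \<open>pCons 0 0\<close> is a case of its own and rests on \<open>R 0 = 0\<close>.\<close>
    by (cases "p = 0 \<and> a = 0") (auto simp: P_def R.zero)
  have "P (p + q) = P p + P q" for p q
    by (induction p q rule: poly_induct2) (auto simp: P_0 P_pCons R.add scale_left_distrib algebra_simps)
  moreover have "P (smult c p) = scale c (P p)" for c p
    by (induction p) (auto simp: P_0 P_pCons R.scale scale_right_distrib)
  ultimately show ?thesis using P_0 P_pCons by blast
qed

text \<open>If \<open>K0\<close> is invariant, \<open>h\<close> represents an eigenvector of the operator induced on \<open>K / K0\<close>.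
  The proof takes a polynomial \<open>p\<close> of least degree with \<open>p(R) g \<in> K0\<close> and divides it by \<open>X - \<nu>\<close>
  for a root \<open>\<nu>\<close>.\<close>

lemma exists_eigenvector_mod_subspace:
  fixes scale :: "complex \<Rightarrow> 'b::ab_group_add \<Rightarrow> 'b"
  assumes "vector_space scale" and R: "Vector_Spaces.linear scale scale R"
    and K: "module.subspace scale K" and inv: "\<And>x. x \<in> K \<Longrightarrow> R x \<in> K"
    and B: "finite B" "K \<subseteq> module.span scale B"
    and K0: "module.subspace scale K0" and g: "g \<in> K" "g \<notin> K0"
  shows "\<exists>\<nu> h. h \<in> K \<and> h \<notin> K0 \<and> R h - scale \<nu> h \<in> K0"
proof -
  interpret vector_space scale by fact
  interpret R: Vector_Spaces.linear scale scale R by (rule R)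
  obtain P where P: "\<And>p q. P (p + q) = P p + P q" "\<And>c p. P (smult c p) = scale c (P p)"
    "\<And>a p. P (pCons a p) = scale a g + R (P p)" "P 0 = 0"
    using exists_polynomial_action[OF R, of g] by blast
  have PK: "P p \<in> K" for p
    by (induction p) (auto simp: P(3,4) intro!: subspace_add subspace_scale subspace_0 K g inv)
  then obtain p1 where "p1 \<noteq> 0" "P p1 \<in> K0"
    using exists_poly_annihilating[of P, OF P(1,2) B(1)] B(2) subspace_0[OF K0] by fastforce
  then obtain p where p: "p \<noteq> 0" "P p \<in> K0"
    and least: "\<And>q. q \<noteq> 0 \<Longrightarrow> P q \<in> K0 \<Longrightarrow> degree p \<le> degree q"
    using ex_has_least_nat[of "\<lambda>q. q \<noteq> 0 \<and> P q \<in> K0" p1 degree] by blast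
  \<comment> \<open>A nonzero constant \<open>p\<close> would put a nonzero multiple of
    \<open>g\<close>, hence \<open>g\<close> itself, into \<open>K0\<close>.\<close>
  have "\<not> constant (poly p)"
  proof
    assume "constant (poly p)"
    then obtain a where a: "p = [:a:]"
      using constant_degree degree_eq_zeroE by metis
    with p have "a \<noteq> 0" "scale a g \<in> K0" by (auto simp: P R.zero)
    then show False using subspace_scale[OF K0, of "scale a g" "inverse a"] g by simp
  qed
  then obtain \<nu> where "poly p \<nu> = 0" using fundamental_theorem_of_algebra by blast
  then obtain q where q: "p = [:- \<nu>, 1:] * q" by (auto simp: poly_eq_0_iff_dvd)
  with p have "q \<noteq> 0" by auto
  then have "degree p = Suc (degree q)" unfolding q by (subst degree_mult_eq) auto
  with least \<open>q \<noteq> 0\<close> have "P q \<notin> K0" by force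
  moreover have "P p = R (P q) - scale \<nu> (P q)"
  proof -
    have "p = smult (- \<nu>) q + pCons 0 q" unfolding q by simp
    then show ?thesis by (simp only: P) simp
  qed
  ultimately show ?thesis using PK p(2) by metis
qed

section \<open>The Hermitian product and adjoint matrices\<close>

lemma cdot_add_left: "cdot (u + v) w = cdot u w + cdot v w"
  by (simp add: cdot_def algebra_simps sum.distrib)

lemma cdot_add_right: "cdot w (u + v) = cdot w u + cdot w v"
  by (simp add: cdot_def algebra_simps sum.distrib)

lemma cdot_diff_left: "cdot (u - v) w = cdot u w - cdot v w"
  by (simp add: cdot_def algebra_simps sum_subtractf)

lemma cdot_diff_right: "cdot w (u - v) = cdot w u - cdot w v"
  by (simp add: cdot_def algebra_simps sum_subtractf)

lemma cdot_minus_left: "cdot (- u) w = - cdot u w"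
  by (simp add: cdot_def sum_negf)

lemma cdot_minus_right: "cdot w (- u) = - cdot w u"
  by (simp add: cdot_def sum_negf)

lemma cdot_scale_left: "cdot (c *s u) w = cnj c * cdot u w"
  by (simp add: cdot_def sum_distrib_left mult_ac)

lemma cdot_scale_right: "cdot w (c *s u) = c * cdot w u"
  by (simp add: cdot_def sum_distrib_left mult_ac)

lemma cdot_zero_left [simp]: "cdot 0 w = 0"
  by (simp add: cdot_def)

lemma cdot_zero_right [simp]: "cdot w 0 = 0"
  by (simp add: cdot_def)

lemmas cdot_linear = cdot_add_left cdot_add_right cdot_diff_left cdot_diff_right cdot_minus_left
  cdot_minus_right cdot_scale_left cdot_scale_right

lemma cnj_cdot: "cnj (cdot v w) = cdot w v"
  by (simp add: cdot_def mult.commute)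

lemma cdot_self: "cdot v v = of_real (\<Sum>i\<in>UNIV. (cmod (v $ i))\<^sup>2)"
  unfolding cdot_def of_real_sum by (intro sum.cong refl) (simp add: complex_norm_square[symmetric] mult.commute)

lemma cdot_self_eq_0_iff: "cdot v v = 0 \<longleftrightarrow> v = 0"
  unfolding cdot_self of_real_eq_0_iff by (subst sum_nonneg_eq_0_iff) (auto simp: vec_eq_iff)

lemma cdot_matrix_right: "cdot v (A *v w) = cdot (adj A *v v) w"
proof -
  have "cdot v (A *v w) = (\<Sum>i\<in>UNIV. \<Sum>j\<in>UNIV. cnj (v $ i) * A $ i $ j * w $ j)"
    by (simp add: cdot_def matrix_vector_mult_def sum_distrib_left mult_ac)
  also have "\<dots> = (\<Sum>j\<in>UNIV. \<Sum>i\<in>UNIV. cnj (v $ i) * A $ i $ j * w $ j)"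
    by (rule sum.swap)
  also have "\<dots> = cdot (adj A *v v) w"
    by (simp add: cdot_def adj_def map_matrix_def transpose_def matrix_vector_mult_def
        sum_distrib_left sum_distrib_right mult_ac)
  finally show ?thesis .
qed

lemma matrix_vector_mult_minus_left: "(- A) *v x = - (A *v x)" for A :: "'a::ring_1 ^ 'n ^ 'm"
  by (simp add: vec_eq_iff matrix_vector_mult_def sum_negf)

lemma matrix_vector_mult_minus_right: "A *v (- x) = - (A *v x)" for A :: "'a::ring_1 ^ 'n ^ 'm"
  by (simp add: vec_eq_iff matrix_vector_mult_def sum_negf)

lemma matrix_mult_minus_left: "(- A) ** B = - (A ** B)" for A :: "'a::ring_1 ^ 'n ^ 'm"
  by (simp add: vec_eq_iff matrix_matrix_mult_def sum_negf)

lemma matrix_mult_minus_right: "A ** (- B) = - (A ** B)" for A :: "'a::ring_1 ^ 'n ^ 'm"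
  by (simp add: vec_eq_iff matrix_matrix_mult_def sum_negf)

lemmas matrix_minus = matrix_vector_mult_minus_left matrix_vector_mult_minus_right
  matrix_mult_minus_left matrix_mult_minus_right

lemma adj_nth: "adj A $ i $ j = cnj (A $ j $ i)"
  by (simp add: adj_def map_matrix_def transpose_def)

lemma adj_adj [simp]: "adj (adj A) = A"
  by (simp add: vec_eq_iff adj_nth)

lemma adj_mult: "adj (A ** B) = adj B ** adj A"
  by (simp add: vec_eq_iff adj_nth matrix_matrix_mult_def mult.commute)

lemma cdot_matrix_left: "cdot (A *v v) w = cdot v (adj A *v w)"
  by (simp add: cdot_matrix_right)

section \<open>The symplectic form, isotropic kernels and semidefinite matrices\<close>

lemma sum_UNIV_sum:
  "(\<Sum>i\<in>UNIV. h i) = (\<Sum>a\<in>UNIV. h (Inl a :: 'a::finite + 'b::finite)) + (\<Sum>b\<in>UNIV. h (Inr b))"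
  by (subst UNIV_Plus_UNIV[symmetric], subst sum.Plus) auto

lemma J_mult_vec: "J *v v = (\<chi> i. case i of Inl a \<Rightarrow> - v $ Inr a | Inr a \<Rightarrow> v $ Inl a)"
  by (auto simp: vec_eq_iff matrix_vector_mult_def J_def sum_UNIV_sum if_distrib[of "\<lambda>x. x * _"]
      cong: if_cong split: sum.split)

lemma J_J_vec [simp]: "J *v (J *v v) = - v"
  by (auto simp: vec_eq_iff J_mult_vec split: sum.split)

lemma J_J: "J ** J = - mat 1"
  by (simp add: matrix_eq matrix_vector_mul_assoc[symmetric] matrix_minus)

lemma adj_J: "adj J = - J"
  by (auto simp: vec_eq_iff adj_nth J_def split: sum.split)

text \<open>The \<open>2n \<times> 2n\<close> matrix with column blocks \<open>\<alpha>\<^sup>*\<close> and \<open>J \<alpha>\<^sup>*\<close> is unitary.\<close>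

lemma Gamma_bc_kernel:
  assumes "\<alpha> \<in> Gamma_bc" "\<alpha> *v v = 0"
  shows "v = - (J ** adj \<alpha>) *v (\<alpha> *v (J *v v))"
proof -
  have a: "\<alpha> ** adj \<alpha> = mat 1" "\<alpha> ** J ** adj \<alpha> = 0"
    using assms(1) by (auto simp: Gamma_bc_def)
  define Q where "Q = J ** adj \<alpha>"
  have aQ: "\<alpha> ** Q = 0" using a(2) by (simp add: Q_def matrix_mul_assoc)
  have adjQ: "adj Q = - (\<alpha> ** J)" by (simp add: Q_def adj_mult adj_J matrix_minus)
  have QQ: "adj Q ** Q = mat 1"
  proof -
    have "adj Q ** Q = - (\<alpha> ** (J ** J) ** adj \<alpha>)"
      unfolding adjQ unfolding Q_def by (simp add: matrix_mul_assoc matrix_minus)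
    then show ?thesis by (simp add: J_J a matrix_minus)
  qed
  have Qa: "adj Q ** adj \<alpha> = 0"
    unfolding adjQ by (simp add: a matrix_minus)
  define W where "W = (\<chi> i j. case j of Inl b \<Rightarrow> adj \<alpha> $ i $ b | Inr b \<Rightarrow> Q $ i $ b)"
  have "adj W ** W = mat 1"
  proof -
    have "(adj W ** W) $ i $ j = (case i of
       Inl b \<Rightarrow> (case j of Inl c \<Rightarrow> (\<alpha> ** adj \<alpha>) $ b $ c | Inr c \<Rightarrow> (\<alpha> ** Q) $ b $ c)
     | Inr b \<Rightarrow> (case j of Inl c \<Rightarrow> (adj Q ** adj \<alpha>) $ b $ c | Inr c \<Rightarrow> (adj Q ** Q) $ b $ c))" for i j
      by (auto simp: matrix_matrix_mult_def W_def adj_nth split: sum.split)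
    then show ?thesis
      unfolding a aQ QQ Qa by (auto simp: vec_eq_iff mat_def split: sum.split)
  qed
  \<comment> \<open>For a square matrix a left inverse is also a right inverse. This resolves the
    identity into two terms, the first of which annihilates the kernel of
    \<open>\<alpha>\<close>.\<close>
  then have "W ** adj W = mat 1" by (simp add: matrix_left_right_inverse)
  moreover have "W ** adj W = adj \<alpha> ** \<alpha> + Q ** adj Q"
    by (auto simp: vec_eq_iff matrix_matrix_mult_def W_def adj_nth sum_UNIV_sum)
  ultimately have "v = (adj \<alpha> ** \<alpha> + Q ** adj Q) *v v" by simp
  also have "\<dots> = adj \<alpha> *v (\<alpha> *v v) + Q *v (adj Q *v v)"
    by (simp add: matrix_vector_mult_add_rdistrib matrix_vector_mul_assoc)
  also have "\<dots> = - Q *v (\<alpha> *v (J *v v))"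
    by (simp add: assms adjQ matrix_minus matrix_vector_mul_assoc[symmetric])
  finally show ?thesis by (simp add: Q_def)
qed

text \<open>\<open>J\<close> maps the kernel of \<open>\<alpha>\<close> into the range of
  \<open>adj \<alpha>\<close>, which is orthogonal to that kernel. This removes the boundary terms
  in the Lagrange identity.\<close>

lemma Gamma_bc_isotropic:
  assumes "\<alpha> \<in> Gamma_bc" "\<alpha> *v u = 0" "\<alpha> *v v = 0"
  shows "cdot u (J *v v) = 0"
proof -
  obtain \<eta> where "v = - (J ** adj \<alpha>) *v \<eta>" using Gamma_bc_kernel[OF assms(1,3)] by blast
  then have "J *v v = adj \<alpha> *v \<eta>"
    by (simp add: matrix_minus matrix_vector_mul_assoc[symmetric])
  then show ?thesis using assms(2) by (simp add: cdot_matrix_right)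
qed

text \<open>The form is nonnegative at \<open>v + t w\<close> with \<open>w = A v\<close> and every
  real \<open>t\<close>. Since its constant term vanishes, so must its linear coefficient, which is
  twice the squared length of \<open>w\<close>.\<close>

lemma psd_kernel:
  assumes "psd A" "cdot v (A *v v) = 0"
  shows "A *v v = 0"
proof -
  define w where "w = A *v v"
  define a where "a = Re (cdot w w)"
  define b where "b = Re (cdot w (A *v w))"
  have herm: "adj A = A" and nn: "\<And>x. 0 \<le> Re (cdot x (A *v x))"
    using assms(1) by (auto simp: psd_def less_eq_complex_def)
  have "cdot v (A *v w) = cdot w w"
    by (simp add: cdot_matrix_right herm flip: w_def)
  then have "Re (cdot (v + of_real t *s w) (A *v (v + of_real t *s w))) = 2 * t * a + t\<^sup>2 * b" for t
    using assms(2)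
    by (simp add: matrix_vector_right_distrib vector_scalar_commute cdot_linear a_def b_def
        power2_eq_square algebra_simps flip: w_def)
  then have q: "0 \<le> 2 * t * a + t\<^sup>2 * b" for t using nn by metis
  have "b \<ge> 0" using nn by (simp add: b_def)
  \<comment> \<open>The minimiser would be \<open>t = - a / b\<close>; the denominator
    \<open>b + 1\<close> also covers \<open>b = 0\<close> and still makes the value negative unless
    \<open>a = 0\<close>.\<close>
  have "2 * (- a / (b + 1)) * a + (- a / (b + 1))\<^sup>2 * b = - (a\<^sup>2 * (b + 2) / (b + 1)\<^sup>2)"
    using \<open>b \<ge> 0\<close> by (simp add: divide_simps power2_eq_square) algebra
  with q[of "- a / (b + 1)"] have "a\<^sup>2 * (b + 2) / (b + 1)\<^sup>2 \<le> 0" by linarith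
  then have "a\<^sup>2 \<le> 0" using \<open>b \<ge> 0\<close>
    by (simp add: divide_le_0_iff mult_le_0_iff)
  then have "a = 0" by simp
  then show ?thesis
    unfolding a_def cdot_self Re_complex_of_real w_def[symmetric]
    by (subst (asm) sum_nonneg_eq_0_iff) (auto simp: vec_eq_iff)
qed

section \<open>The space of sequences and its semi-inner product\<close>

lemma sum_fun_apply: "(\<Sum>i\<in>I. h i) k = (\<Sum>i\<in>I. h i k)" for h :: "'a \<Rightarrow> 'b \<Rightarrow> 'c::comm_monoid_add"
  by (induction I rule: infinite_finite_induct) auto

lemma minus_fun_apply [simp]: "(z - u) k = z k - u k" for z u :: "'b \<Rightarrow> 'c::group_add"
  by (simp add: fun_diff_def)

lemma seq_scale_apply [simp]: "seq_scale c z k = c *s z k"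
  by (simp add: seq_scale_def)

lemma subspace_seqs: "seq.subspace (seqs N)"
  by (auto simp: seq.subspace_def seqs_def)

text \<open>The unit sequences span. The resulting dimension bound serves both the finiteness of the
  spectrum and the search for an eigenvector of the resolvent.\<close>

lemma seqs_finite_span: "\<exists>B. finite B \<and> seqs N \<subseteq> seq.span (B :: 'n::finite sequ set)"
proof (intro exI conjI subsetI)
  let ?e = "\<lambda>(m, i) k. if k = m then axis i 1 else 0 :: 'n vec2"
  let ?B = "?e ` ({..N + 1} \<times> UNIV)"
  show "finite ?B" by simp
  fix z :: "'n sequ" assume z: "z \<in> seqs N"
  have "(\<Sum>m\<le>N + 1. \<Sum>i\<in>UNIV. seq_scale (z m $ i) (?e (m, i))) k = z k" for k
  proof (cases "k \<le> N + 1")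
    case True
    have "(\<Sum>m\<le>N + 1. \<Sum>i\<in>UNIV. seq_scale (z m $ i) (?e (m, i))) k
        = (\<Sum>m\<le>N + 1. if k = m then \<Sum>i\<in>UNIV. z m $ i *s axis i 1 else 0)"
      unfolding sum_fun_apply by (intro sum.cong) auto
    also have "\<dots> = (\<Sum>i\<in>UNIV. z k $ i *s axis i 1)"
      using True by (subst sum.delta') auto
    finally show ?thesis by (simp add: basis_expansion)
  next
    case False
    then have "(\<Sum>m\<le>N + 1. \<Sum>i\<in>UNIV. seq_scale (z m $ i) (?e (m, i))) k = 0"
      unfolding sum_fun_apply by (intro sum.neutral) auto
    then show ?thesis using z False by (simp add: seqs_def)
  qed
  then have "z = (\<Sum>m\<le>N + 1. \<Sum>i\<in>UNIV. seq_scale (z m $ i) (?e (m, i)))" by auto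
  also have "\<dots> \<in> seq.span ?B"
    by (intro seq.span_sum seq.span_scale seq.span_base imageI) auto
  finally show "z \<in> seq.span ?B" .
qed

lemma psi_inner_linear:
  "psi_inner N \<Psi> z (u + v) = psi_inner N \<Psi> z u + psi_inner N \<Psi> z v"
  "psi_inner N \<Psi> z (u - v) = psi_inner N \<Psi> z u - psi_inner N \<Psi> z v"
  "psi_inner N \<Psi> z (seq_scale c u) = c * psi_inner N \<Psi> z u"
  "psi_inner N \<Psi> (u + v) z = psi_inner N \<Psi> u z + psi_inner N \<Psi> v z"
  "psi_inner N \<Psi> (u - v) z = psi_inner N \<Psi> u z - psi_inner N \<Psi> v z"
  "psi_inner N \<Psi> (seq_scale c u) z = cnj c * psi_inner N \<Psi> u z"
  by (simp_all add: psi_inner_def cdot_linear matrix_vector_right_distrib matrix_vector_mult_diff_distrib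
      vector_scalar_commute sum.distrib sum_subtractf sum_distrib_left)

lemma psi_inner_zero [simp]: "psi_inner N \<Psi> z 0 = 0"
  by (simp add: psi_inner_def)

lemma psi_inner_sum_right: "psi_inner N \<Psi> z (\<Sum>i\<in>I. h i) = (\<Sum>i\<in>I. psi_inner N \<Psi> z (h i))"
  by (induction I rule: infinite_finite_induct)
    (simp_all only: sum.infinite sum.empty sum.insert not_False_eq_True psi_inner_zero psi_inner_linear)

section \<open>One step of the system, and the inhomogeneous recursion\<close>

lemma SS_mult_vec: "SS S \<Psi> \<mu> k *v x = S k *v x - \<mu> *s (J *v (\<Psi> k *v (S k *v x)))"
proof -
  have "map_matrix ((*) \<mu>) (V_coeff S \<Psi> k) *v x = \<mu> *s (V_coeff S \<Psi> k *v x)"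
    by (simp add: vec_eq_iff matrix_vector_mult_def map_matrix_def sum_distrib_left mult_ac)
  then show ?thesis
    by (simp add: SS_def V_coeff_def matrix_vector_mult_add_rdistrib matrix_minus matrix_vector_mul_assoc
        matrix_mul_assoc)
qed

text \<open>The recursion runs down from a prescribed terminal value \<open>v\<close>, and the
  initial value is affine in \<open>v\<close>. The order of quantifiers matters: \<open>C\<close> is
  the same for all inhomogeneities \<open>b\<close>, and \<open>d\<close> depends on
  \<open>b\<close> but not on \<open>v\<close>.\<close>

lemma backward_recursion:
  fixes A :: "nat \<Rightarrow> 'n::finite mat2"
  shows "\<exists>C. \<forall>b. \<exists>d. \<forall>v. \<exists>z. z M = v \<and> z 0 = C *v v + d \<and> (\<forall>k<M. z k = A k *v z (k + 1) + b k)"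
proof (induction M)
  case 0
  have "\<exists>z. z 0 = v \<and> z 0 = mat 1 *v v + 0 \<and> (\<forall>k<0. z k = A k *v z (k + 1) + b k)" for b v
    by (rule exI[of _ "\<lambda>_. v"]) simp
  then show ?case by blast
next
  case (Suc M)
  then obtain C where C: "\<And>b. \<exists>d. \<forall>v. \<exists>z. z M = v \<and> z 0 = C *v v + d \<and> (\<forall>k<M. z k = A k *v z (k + 1) + b k)"
    by blast
  show ?case
  proof (rule exI[of _ "C ** A M"], intro allI)
    fix b
    obtain d where d: "\<And>v. \<exists>z. z M = v \<and> z 0 = C *v v + d \<and> (\<forall>k<M. z k = A k *v z (k + 1) + b k)"
      using C by blast
    show "\<exists>d. \<forall>v. \<exists>z. z (Suc M) = v \<and> z 0 = (C ** A M) *v v + d \<and> (\<forall>k<Suc M. z k = A k *v z (k + 1) + b k)"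
    proof (rule exI[of _ "C *v b M + d"], rule allI)
      fix v
      obtain z where z: "z M = A M *v v + b M" "z 0 = C *v (A M *v v + b M) + d"
        "\<forall>k<M. z k = A k *v z (k + 1) + b k"
        using d by blast
      then have "(z(Suc M := v)) (Suc M) = v \<and> (z(Suc M := v)) 0 = (C ** A M) *v v + (C *v b M + d) \<and>
        (\<forall>k<Suc M. (z(Suc M := v)) k = A k *v (z(Suc M := v)) (k + 1) + b k)"
        by (auto simp: matrix_vector_right_distrib matrix_vector_mul_assoc less_Suc_eq)
      then show "\<exists>z. z (Suc M) = v \<and> z 0 = (C ** A M) *v v + (C *v b M + d) \<and>
        (\<forall>k<Suc M. z k = A k *v z (k + 1) + b k)" by blast
    qed
  qed
qed

section \<open>The boundary value problem as a symmetric linear relation\<close>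

locale symplectic_bvp =
  fixes N :: nat and S \<Psi> :: "nat \<Rightarrow> 'n::finite mat2" and \<alpha> \<beta> :: "complex ^ ('n + 'n) ^ 'n"
  assumes coefficients: "coefficients_ok N S \<Psi>"
    and alpha: "\<alpha> \<in> Gamma_bc" and beta: "\<beta> \<in> Gamma_bc"
    and Atkinson: "weak_Atkinson N S \<Psi> \<alpha>"
begin

abbreviation "ip \<equiv> psi_inner N \<Psi>"
abbreviation "bvp \<equiv> solves_bvp N S \<Psi> \<alpha> \<beta>"
abbreviation "E \<equiv> Eigen N S \<Psi> \<alpha> \<beta>"

text \<open>These turn out to be the sequences of zero seminorm
  (\<open>inner_self_eq_0_iff\<close>); in this pointwise form they visibly make up a
  subspace.\<close>

definition "null z \<longleftrightarrow> (\<forall>k\<le>N. \<Psi> k *v z k = 0)"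

lemma S_isometry:
  assumes "k \<le> N"
  shows "cdot (S k *v u) (J *v (S k *v v)) = cdot u (J *v v)"
proof -
  have "adj (S k) ** J ** S k = J"
    using coefficients assms by (auto simp: coefficients_ok_def)
  then show ?thesis
    by (simp add: cdot_matrix_left matrix_vector_mul_assoc matrix_mul_assoc)
qed

text \<open>Pairing the images of \<open>J v\<close> and \<open>v\<close> under \<open>S k\<close>
  gives the squared length of \<open>J v\<close>, which is therefore zero.\<close>

lemma S_eq_0:
  assumes "k \<le> N" "S k *v v = 0"
  shows "v = 0"
  using S_isometry[OF assms(1), of "J *v v" v] assms(2)
  by (simp add: cdot_self_eq_0_iff) (metis J_J_vec matrix_vector_mult_0_right neg_equal_0_iff_equal)

lemma adj_Psi: "k \<le> N \<Longrightarrow> adj (\<Psi> k) = \<Psi> k"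
  and psd_Psi: "k \<le> N \<Longrightarrow> psd (\<Psi> k)"
  using coefficients by (auto simp: coefficients_ok_def)

lemma Psi_J_Psi: "k \<le> N \<Longrightarrow> \<Psi> k *v (J *v (\<Psi> k *v v)) = 0"
  using coefficients by (auto simp: coefficients_ok_def matrix_vector_mul_assoc matrix_mul_assoc)

text \<open>By \<open>Psi_J_Psi\<close>, either equation yields
  \<open>\<Psi> x = \<Psi> S y\<close>, so the parameter may multiply \<open>x\<close> instead of
  \<open>S y\<close>. Thus an eigenfunction is a solution of the boundary value problem with
  right-hand side \<open>\<mu> z\<close>.\<close>

lemma SS_step_iff:
  assumes "k \<le> N"
  shows "x = SS S \<Psi> \<mu> k *v y \<longleftrightarrow> x = S k *v y - J *v (\<Psi> k *v (\<mu> *s x))"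
proof
  assume x: "x = SS S \<Psi> \<mu> k *v y"
  then have "\<Psi> k *v x = \<Psi> k *v (S k *v y)"
    using Psi_J_Psi[OF assms]
    by (simp add: SS_mult_vec matrix_vector_mult_diff_distrib vector_scalar_commute)
  then have "J *v (\<Psi> k *v (\<mu> *s x)) = \<mu> *s (J *v (\<Psi> k *v (S k *v y)))"
    by (simp add: vector_scalar_commute)
  then show "x = S k *v y - J *v (\<Psi> k *v (\<mu> *s x))"
    using x by (simp only: SS_mult_vec)
next
  assume x: "x = S k *v y - J *v (\<Psi> k *v (\<mu> *s x))"
  have "\<Psi> k *v x = \<Psi> k *v (S k *v y)"
    by (subst x) (simp add: Psi_J_Psi[OF assms] matrix_vector_mult_diff_distrib)
  then show "x = SS S \<Psi> \<mu> k *v y"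
    using x by (simp add: SS_mult_vec vector_scalar_commute)
qed

lemma Eigen_iff: "z \<in> E \<mu> \<longleftrightarrow> z \<in> seqs N \<and> bvp (seq_scale \<mu> z) z"
  by (auto simp: Eigen_def solves_def solves_bvp_def SS_step_iff)

lemma SS_eq_0:
  assumes "k \<le> N" "SS S \<Psi> \<mu> k *v y = 0"
  shows "y = 0"
  using SS_step_iff[OF assms(1), of 0 \<mu> y] assms S_eq_0[of k y] by simp

lemma bvp_cong: "bvp f z \<Longrightarrow> (\<And>k. k \<le> N \<Longrightarrow> \<Psi> k *v f k = \<Psi> k *v g k) \<Longrightarrow> bvp g z"
  unfolding solves_bvp_def by metis

lemma bvp_add: "bvp f z \<Longrightarrow> bvp g u \<Longrightarrow> bvp (f + g) (z + u)"
  by (auto simp: solves_bvp_def matrix_vector_right_distrib)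

lemma bvp_diff: "bvp f z \<Longrightarrow> bvp g u \<Longrightarrow> bvp (f - g) (z - u)"
  by (auto simp: solves_bvp_def matrix_vector_mult_diff_distrib)

lemma bvp_scale: "bvp f z \<Longrightarrow> bvp (seq_scale c f) (seq_scale c z)"
  unfolding solves_bvp_def seq_scale_apply vector_scalar_commute
  by (metis vector_ssub_ldistrib vector_smult_rzero)

lemma bvp_zero: "bvp 0 0"
  by (simp add: solves_bvp_def)

lemma inner_commute: "ip u z = cnj (ip z u)"
  by (simp add: psi_inner_def cnj_cdot cdot_matrix_right adj_Psi)

text \<open>The bracket \<open>b\<close> of the two solutions telescopes, and it vanishes at both
  ends because the boundary conditions have isotropic kernels.\<close>

lemma Lagrange_identity:
  assumes "bvp f z" "bvp g u"
  shows "ip f u = ip z g"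
proof -
  define b where "b k = cdot (z k) (J *v u k)" for k
  have step: "b (Suc k) - b k = cdot (f k) (\<Psi> k *v u k) - cdot (z k) (\<Psi> k *v g k)" if "k \<le> N" for k
  proof -
    have "S k *v z (Suc k) = z k + J *v (\<Psi> k *v f k)" "S k *v u (Suc k) = u k + J *v (\<Psi> k *v g k)"
      using assms that by (auto simp: solves_bvp_def)
    then have "b (Suc k) = cdot (z k + J *v (\<Psi> k *v f k)) (J *v (u k + J *v (\<Psi> k *v g k)))"
      using S_isometry[OF that, of "z (Suc k)" "u (Suc k)"] by (simp add: b_def)
    \<comment> \<open>The term containing both \<open>f\<close> and \<open>g\<close> drops out by
      \<open>Psi_J_Psi\<close>.\<close>
    also have "\<dots> = b k - cdot (z k) (\<Psi> k *v g k) + cdot (f k) (\<Psi> k *v u k)"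
      using Psi_J_Psi[OF that]
      by (simp add: b_def matrix_vector_right_distrib cdot_linear cdot_matrix_left adj_J adj_Psi[OF that]
          matrix_minus)
    finally show ?thesis by simp
  qed
  have "b (Suc N) - b 0 = (\<Sum>k\<le>N. b (Suc k) - b k)"
    using sum_lessThan_telescope[of b "Suc N"] by (simp add: lessThan_Suc_atMost)
  also have "\<dots> = ip f u - ip z g"
    by (simp add: step psi_inner_def sum_subtractf)
  finally have "b (Suc N) - b 0 = ip f u - ip z g" .
  moreover have "b 0 = 0"
    unfolding b_def using assms by (intro Gamma_bc_isotropic[OF alpha]) (auto simp: solves_bvp_def)
  moreover have "b (Suc N) = 0"
    unfolding b_def using assms by (intro Gamma_bc_isotropic[OF beta]) (auto simp: solves_bvp_def)
  ultimately show ?thesis by simp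
qed

lemma inner_nonneg: "0 \<le> ip z z"
  using psd_Psi by (auto simp: psi_inner_def psd_def intro!: sum_nonneg)

lemma inner_null: "null z \<Longrightarrow> ip u z = 0"
  by (simp add: null_def psi_inner_def)

lemma inner_self_eq_0_iff: "ip z z = 0 \<longleftrightarrow> null z"
proof
  assume "ip z z = 0"
  then have "\<forall>k\<le>N. cdot (z k) (\<Psi> k *v z k) = 0"
    unfolding psi_inner_def using psd_Psi by (subst (asm) sum_nonneg_eq_0_iff) (auto simp: psd_def)
  then show "null z" using psd_kernel psd_Psi by (auto simp: null_def)
qed (rule inner_null)

text \<open>With \<open>z\<close> and \<open>f\<close> null, \<open>z\<close> solves the homogeneous
  system for every parameter, in particular for the one in the Atkinson condition. There
  \<open>z\<close> has the form \<open>Z \<eta>\<close>, and zero seminorm forces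
  \<open>\<eta> = 0\<close>.\<close>

lemma nondegenerate:
  assumes z: "z \<in> seqs N" "bvp f z" and null: "null z" and f: "null f"
  shows "z = 0"
proof -
  obtain \<mu> Z where Z: "is_Z_tilde N S \<Psi> \<alpha> \<mu> Z"
    and pos: "\<And>\<eta>. \<eta> \<noteq> 0 \<Longrightarrow> 0 < (\<Sum>k\<le>N. cdot (Z k *v \<eta>) (\<Psi> k *v (Z k *v \<eta>)))"
    using Atkinson by (auto simp: weak_Atkinson_def)
  \<comment> \<open>This is the vector that \<open>Gamma_bc_kernel\<close> supplies for
    \<open>z 0\<close>, so that \<open>z 0 = Z 0 \<eta>\<close>.\<close>
  define \<eta> where "\<eta> = \<alpha> *v (J *v z 0)"
  have step: "z k = SS S \<Psi> \<mu> k *v z (Suc k)" if "k \<le> N" for k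
    using that z null f by (subst SS_step_iff) (auto simp: solves_bvp_def null_def vector_scalar_commute)
  have zZ: "z k = Z k *v \<eta>" if "k \<le> N + 1" for k
    using that
  proof (induction k)
    case 0
    have "\<alpha> *v z 0 = 0" using z(2) unfolding solves_bvp_def by blast
    then show ?case
      using Gamma_bc_kernel[OF alpha] Z by (simp add: \<eta>_def is_Z_tilde_def)
  next
    case (Suc k)
    then have "SS S \<Psi> \<mu> k *v z (Suc k) = SS S \<Psi> \<mu> k *v (Z (Suc k) *v \<eta>)"
      using step[of k] Z by (simp add: is_Z_tilde_def matrix_vector_mul_assoc)
    then show ?case
      \<comment> \<open>The system expresses index \<open>k\<close> by index \<open>k + 1\<close>;
        going upwards takes the injectivity of the step matrix. The induction includes index
        \<open>N + 1\<close>, where the seminorm sees nothing.\<close>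
      using SS_eq_0[of k \<mu> "z (Suc k) - Z (Suc k) *v \<eta>"] Suc.prems
      by (simp add: matrix_vector_mult_diff_distrib)
  qed
  have "\<eta> = 0"
  proof (rule ccontr)
    assume "\<eta> \<noteq> 0"
    then have "0 < (\<Sum>k\<le>N. cdot (Z k *v \<eta>) (\<Psi> k *v (Z k *v \<eta>)))" by (rule pos)
    also have "\<dots> = ip z z" by (simp add: psi_inner_def zZ)
    finally show False using null inner_null by simp
  qed
  then have "z k = 0" for k
    using zZ z(1) by (cases "k \<le> N + 1") (auto simp: seqs_def)
  then show ?thesis by auto
qed

section \<open>Reality, orthogonality and finiteness of the spectrum\<close>

lemma Eigen_null:
  assumes "z \<in> E \<mu>" "ip z z = 0"
  shows "z = 0"
proof -
  have "null z" using assms inner_self_eq_0_iff by blast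
  then show ?thesis
    using assms(1) by (intro nondegenerate[of z "seq_scale \<mu> z"])
      (auto simp: Eigen_iff null_def vector_scalar_commute)
qed

lemma eigenvalue_real:
  assumes "\<mu> \<in> eigenvalues N S \<Psi> \<alpha> \<beta>"
  shows "cnj \<mu> = \<mu>"
proof -
  obtain z where z: "z \<in> E \<mu>" "z \<noteq> 0" using assms by (auto simp: eigenvalues_def)
  have "cnj \<mu> * ip z z = \<mu> * ip z z"
    using Lagrange_identity[of "seq_scale \<mu> z" z "seq_scale \<mu> z" z] z(1)
    by (simp add: Eigen_iff psi_inner_linear)
  then show ?thesis using Eigen_null z by auto
qed

lemma Eigen_orthogonal:
  assumes "z \<in> E \<mu>" "u \<in> E \<nu>" "\<mu> \<noteq> \<nu>"
  shows "ip z u = 0"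
proof (cases "z = 0")
  case True
  then show ?thesis by (simp add: psi_inner_def)
next
  case False
  then have "cnj \<mu> = \<mu>" using assms(1) eigenvalue_real by (auto simp: eigenvalues_def)
  then show ?thesis
    using Lagrange_identity[of "seq_scale \<mu> z" z "seq_scale \<nu> u" u] assms
    by (simp add: Eigen_iff psi_inner_linear)
qed

text \<open>One nonzero eigenfunction per eigenvalue gives an orthogonal family of nonzero seminorm,
  which is independent in a finite-dimensional space.\<close>

lemma finite_eigenvalues: "finite (eigenvalues N S \<Psi> \<alpha> \<beta>)"
proof -
  let ?L = "eigenvalues N S \<Psi> \<alpha> \<beta>"
  have "\<forall>\<mu>\<in>?L. \<exists>z. z \<in> E \<mu> \<and> z \<noteq> 0" unfolding eigenvalues_def by blast
  from bchoice[OF this] obtain e where e: "\<And>\<mu>. \<mu> \<in> ?L \<Longrightarrow> e \<mu> \<in> E \<mu> \<and> e \<mu> \<noteq> 0"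
    by blast
  have ortho: "ip (e \<mu>) (e \<nu>) = 0" if "\<mu> \<in> ?L" "\<nu> \<in> ?L" "\<mu> \<noteq> \<nu>" for \<mu> \<nu>
    using that e Eigen_orthogonal by blast
  have pos: "ip (e \<mu>) (e \<mu>) \<noteq> 0" if "\<mu> \<in> ?L" for \<mu>
    using that e Eigen_null by blast
  have inj: "inj_on e ?L"
  proof (rule inj_onI, rule ccontr)
    fix \<mu> \<nu> assume "\<mu> \<in> ?L" "\<nu> \<in> ?L" "e \<mu> = e \<nu>" "\<mu> \<noteq> \<nu>"
    then show False using ortho[of \<mu> \<nu>] pos[of \<nu>] by simp
  qed
  obtain B :: "'n sequ set" where B: "finite B" "seqs N \<subseteq> seq.span B"
    using seqs_finite_span by blast
  have "seq.independent (e ` ?L)"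
    unfolding seq.independent_explicit_module
  proof (intro allI impI)
    fix t u v
    assume t: "finite t" "t \<subseteq> e ` ?L" "(\<Sum>v\<in>t. seq_scale (u v) v) = 0" "v \<in> t"
    have vx: "ip v x = 0" if x: "x \<in> t" "x \<noteq> v" for x
    proof -
      obtain \<mu> where "\<mu> \<in> ?L" "v = e \<mu>" using t(2,4) by blast
      moreover obtain \<nu> where "\<nu> \<in> ?L" "x = e \<nu>" using t(2) x by blast
      ultimately show ?thesis using ortho[of \<mu> \<nu>] x(2) by blast
    qed
    have "0 = ip v (\<Sum>x\<in>t. seq_scale (u x) x)" using t(3) by simp
    also have "\<dots> = (\<Sum>x\<in>t. u x * ip v x)"
      by (simp add: psi_inner_sum_right psi_inner_linear)
    also have "\<dots> = (\<Sum>x\<in>t. if x = v then u v * ip v v else 0)"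
      using vx by (intro sum.cong refl) auto
    also have "\<dots> = u v * ip v v" using t(1,4) by simp
    finally have "u v * ip v v = 0" by simp
    moreover obtain \<mu> where "\<mu> \<in> ?L" "v = e \<mu>" using t(2,4) by blast
    ultimately show "u v = 0" using pos[of \<mu>] by simp
  qed
  moreover have "e ` ?L \<subseteq> seq.span B" using e B(2) by (auto simp: Eigen_iff)
  ultimately have "finite (e ` ?L)" using seq.independent_span_bound[OF B(1)] by blast
  with inj show ?thesis using finite_imageD by blast
qed

section \<open>The resolvent\<close>

text \<open>Shooting from the right end: terminal values \<open>J (adj \<beta>) \<xi>\<close>
  satisfy the condition at \<open>N + 1\<close>, and the condition at \<open>0\<close> becomes a
  square linear system for \<open>\<xi>\<close> with matrix \<open>G\<close>. A kernel vector of
  \<open>G\<close> would produce an eigenfunction for \<open>\<mu>\<close>.\<close>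

lemma bvp_solvable:
  assumes "\<mu> \<notin> eigenvalues N S \<Psi> \<alpha> \<beta>"
  shows "\<exists>z\<in>seqs N. bvp (g + seq_scale \<mu> z) z"
proof -
  obtain C where "\<And>b. \<exists>d. \<forall>v. \<exists>z. z (N + 1) = v \<and> z 0 = C *v v + d \<and>
      (\<forall>k<N + 1. z k = SS S \<Psi> \<mu> k *v z (k + 1) + b k)"
    using backward_recursion by blast
  then obtain d where d: "\<And>b v. \<exists>z. z (N + 1) = v \<and> z 0 = C *v v + d b \<and>
      (\<forall>k<N + 1. z k = SS S \<Psi> \<mu> k *v z (k + 1) + b k)" by metis
  define G where "G = \<alpha> ** C ** (J ** adj \<beta>)"
  have bb: "\<beta> ** adj \<beta> = mat 1" "\<beta> *v (J *v (adj \<beta> *v \<xi>)) = 0" for \<xi>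
    using beta by (auto simp: Gamma_bc_def matrix_vector_mul_assoc matrix_mul_assoc)
  \<comment> \<open>The recursion says nothing about entries beyond \<open>N + 1\<close>, which must
    vanish in \<open>seqs N\<close>.\<close>
  define trunc :: "'n sequ \<Rightarrow> 'n sequ" where "trunc z k = (if k \<le> N + 1 then z k else 0)" for z k
  have G_eq_0: "\<xi> = 0" if "G *v \<xi> = 0" for \<xi>
  proof -
    \<comment> \<open>Subtracting this solution cancels the offset \<open>d 0\<close>, leaving an
      initial value linear in \<open>\<xi>\<close>.\<close>
    obtain z0 where z0: "z0 (N + 1) = 0" "z0 0 = d 0"
      "\<forall>k<N + 1. z0 k = SS S \<Psi> \<mu> k *v z0 (k + 1)"
      using d[of 0 0] by auto
    obtain z1 where z1: "z1 (N + 1) = J *v (adj \<beta> *v \<xi>)" "z1 0 = C *v (J *v (adj \<beta> *v \<xi>)) + d 0"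
      "\<forall>k<N + 1. z1 k = SS S \<Psi> \<mu> k *v z1 (k + 1)"
      using d[of "J *v (adj \<beta> *v \<xi>)" 0] by auto
    have "trunc (z1 - z0) \<in> E \<mu>"
      using z0 z1 that bb
      by (auto simp: Eigen_def trunc_def seqs_def solves_def matrix_vector_mult_diff_distrib G_def
          matrix_vector_mul_assoc[symmetric])
    then have "trunc (z1 - z0) = 0" using assms by (auto simp: eigenvalues_def)
    then have "trunc (z1 - z0) (N + 1) = 0" by simp
    then have "J *v (adj \<beta> *v \<xi>) = 0" using z0(1) z1(1) by (simp add: trunc_def)
    then have "adj \<beta> *v \<xi> = 0"
      by (metis J_J_vec matrix_vector_mult_0_right neg_equal_0_iff_equal)
    then have "(\<beta> ** adj \<beta>) *v \<xi> = 0" by (simp add: matrix_vector_mul_assoc[symmetric])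
    then show ?thesis by (simp add: bb)
  qed
  then have "\<exists>H. H ** G = mat 1"
    by (simp add: matrix_left_invertible_injective vec.inj_iff_eq_0)
  then obtain H where "G ** H = mat 1" by (auto simp: matrix_left_right_inverse)
  then have GH: "G *v (H *v x) = x" for x by (simp add: matrix_vector_mul_assoc)
  define b where "b k = - (J *v (\<Psi> k *v g k))" for k
  define \<xi> where "\<xi> = - (H *v (\<alpha> *v d b))"
  obtain z where z: "z (N + 1) = J *v (adj \<beta> *v \<xi>)" "z 0 = C *v (J *v (adj \<beta> *v \<xi>)) + d b"
    "\<forall>k<N + 1. z k = SS S \<Psi> \<mu> k *v z (k + 1) + b k"
    using d[of "J *v (adj \<beta> *v \<xi>)" b] by auto
  have "\<alpha> *v z 0 = G *v \<xi> + \<alpha> *v d b"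
    by (simp add: z G_def matrix_vector_right_distrib matrix_vector_mul_assoc[symmetric])
  then have "\<alpha> *v z 0 = 0" by (simp add: \<xi>_def matrix_minus GH)
  moreover have "z k = S k *v z (k + 1) - J *v (\<Psi> k *v (g k + \<mu> *s z k))" if "k \<le> N" for k
  proof -
    have "z k + J *v (\<Psi> k *v g k) = SS S \<Psi> \<mu> k *v z (k + 1)"
      using z(3) that by (simp add: b_def)
    \<comment> \<open>\<open>SS_step_iff\<close> is applied to the shifted vector
      \<open>z k + J \<Psi> g\<close>; \<open>\<Psi>\<close> does not see the shift, again by
      \<open>Psi_J_Psi\<close>.\<close>
    then have "z k + J *v (\<Psi> k *v g k) = S k *v z (k + 1) - J *v (\<Psi> k *v (\<mu> *s (z k + J *v (\<Psi> k *v g k))))"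
      by (simp only: SS_step_iff[OF that])
    then have "z k + J *v (\<Psi> k *v g k) = S k *v z (k + 1) - J *v (\<Psi> k *v (\<mu> *s z k))"
      by (simp add: vector_scalar_commute matrix_vector_right_distrib Psi_J_Psi[OF that])
    then show ?thesis by (simp add: matrix_vector_right_distrib algebra_simps)
  qed
  ultimately have "bvp (g + seq_scale \<mu> (trunc z)) (trunc z)"
    using z(1) bb by (auto simp: solves_bvp_def trunc_def)
  moreover have "trunc z \<in> seqs N" by (auto simp: trunc_def seqs_def)
  ultimately show ?thesis by blast
qed

text \<open>Two solutions for the same \<open>g\<close> differ by an element of
  \<open>E \<mu>\<close>, which is zero. This uniqueness makes the chosen solution linear in
  \<open>g\<close>.\<close>

lemma resolvent_exists:
  assumes "\<mu> \<notin> eigenvalues N S \<Psi> \<alpha> \<beta>"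
  shows "\<exists>R. Vector_Spaces.linear seq_scale seq_scale R \<and>
    (\<forall>g. R g \<in> seqs N \<and> bvp (g + seq_scale \<mu> (R g)) (R g))"
proof -
  obtain R where R: "\<And>g. R g \<in> seqs N" "\<And>g. bvp (g + seq_scale \<mu> (R g)) (R g)"
    using bvp_solvable[OF assms] by metis
  have unique: "z = R g" if z: "z \<in> seqs N" "bvp (g + seq_scale \<mu> z) z" for g z
  proof -
    have "bvp ((g + seq_scale \<mu> z) - (g + seq_scale \<mu> (R g))) (z - R g)"
      using z R by (intro bvp_diff)
    then have "bvp (seq_scale \<mu> (z - R g)) (z - R g)"
      by (simp add: seq.scale_right_diff_distrib)
    moreover have "z - R g \<in> seqs N"
      using z(1) R(1) by (rule seq.subspace_diff[OF subspace_seqs])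
    ultimately have "z - R g \<in> E \<mu>" by (simp add: Eigen_iff)
    then have "z - R g = 0" using assms by (auto simp: eigenvalues_def)
    then show ?thesis by simp
  qed
  have "R (g + h) = R g + R h" for g h
  proof (rule unique[symmetric])
    show "R g + R h \<in> seqs N" using R seq.subspace_add[OF subspace_seqs] by blast
    show "bvp (g + h + seq_scale \<mu> (R g + R h)) (R g + R h)"
      using bvp_add[OF R(2)[of g] R(2)[of h]] by (simp add: seq.scale_right_distrib algebra_simps)
  qed
  moreover have "R (seq_scale c g) = seq_scale c (R g)" for c g
  proof (rule unique[symmetric])
    show "seq_scale c (R g) \<in> seqs N" using R seq.subspace_scale[OF subspace_seqs] by blast
    show "bvp (seq_scale c g + seq_scale \<mu> (seq_scale c (R g))) (seq_scale c (R g))"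
      using bvp_scale[OF R(2)[of g], of c] by (simp add: seq.scale_right_distrib mult.commute)
  qed
  ultimately have "Vector_Spaces.linear seq_scale seq_scale R"
    by (simp add: Vector_Spaces.linear_iff seq.vector_space_axioms)
  with R show ?thesis by blast
qed

section \<open>Completeness of the eigenfunctions\<close>

lemma null_if_orthogonal:
  assumes g: "g \<in> seqs N" "bvp f g" and orth: "\<And>\<mu> e. e \<in> E \<mu> \<Longrightarrow> ip e g = 0"
  shows "null g"
proof (rule ccontr)
  assume "\<not> null g"
  have "finite ((of_real :: real \<Rightarrow> complex) -` eigenvalues N S \<Psi> \<alpha> \<beta>)"
    by (intro finite_vimageI finite_eigenvalues) (auto simp: inj_def)
  then obtain m :: real where "m \<notin> of_real -` eigenvalues N S \<Psi> \<alpha> \<beta>"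
    using ex_new_if_finite[OF infinite_UNIV_char_0] by blast
  then obtain \<mu> :: complex where \<mu>: "\<mu> \<notin> eigenvalues N S \<Psi> \<alpha> \<beta>" "cnj \<mu> = \<mu>"
    by (metis complex_cnj_complex_of_real vimage_eq)
  obtain R where R: "Vector_Spaces.linear seq_scale seq_scale R" "\<And>g. R g \<in> seqs N"
    "\<And>g. bvp (g + seq_scale \<mu> (R g)) (R g)"
    using resolvent_exists[OF \<mu>(1)] by blast
  \<comment> \<open>Membership in the domain of the relation is part of \<open>K\<close> because the
    case \<open>\<nu> = 0\<close> below applies the Lagrange identity to \<open>h\<close>
    itself.\<close>
  define K where "K = {z \<in> seqs N. (\<exists>f. bvp f z) \<and> (\<forall>\<mu>. \<forall>e\<in>E \<mu>. ip e z = 0)}"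
  have K: "seq.subspace K"
    unfolding seq.subspace_def K_def
    using bvp_zero bvp_add bvp_scale seq.subspace_add[OF subspace_seqs]
      seq.subspace_scale[OF subspace_seqs] seq.subspace_0[OF subspace_seqs]
    by (auto simp: psi_inner_linear) blast+
  have K0: "seq.subspace {z. null z}"
    by (auto simp: seq.subspace_def null_def matrix_vector_right_distrib vector_scalar_commute)
  have inv: "R x \<in> K" if x: "x \<in> K" for x
  proof -
    have "ip e (R x) = 0" if e: "e \<in> E \<nu>" for e \<nu>
    proof (cases "e = 0")
      case True
      then show ?thesis by (simp add: psi_inner_def)
    next
      case False
      then have "\<nu> \<in> eigenvalues N S \<Psi> \<alpha> \<beta>" using e by (auto simp: eigenvalues_def)
      then have "cnj \<nu> = \<nu>" "\<nu> \<noteq> \<mu>" using eigenvalue_real \<mu> by auto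
      \<comment> \<open>With \<open>ip e x = 0\<close> this leaves
        \<open>(\<nu> - \<mu>) * ip e (R x) = 0\<close>, whose first factor is nonzero.\<close>
      moreover have "cnj \<nu> * ip e (R x) = ip e x + \<mu> * ip e (R x)"
        using Lagrange_identity[of "seq_scale \<nu> e" e "x + seq_scale \<mu> (R x)" "R x"] e R
        by (simp add: Eigen_iff psi_inner_linear)
      moreover have "ip e x = 0" using x e by (auto simp: K_def)
      ultimately show ?thesis by simp
    qed
    then show ?thesis unfolding K_def using R(2)[of x] R(3)[of x] by blast
  qed
  obtain B :: "'n sequ set" where B: "finite B" "seqs N \<subseteq> seq.span B"
    using seqs_finite_span by blast
  then have KB: "K \<subseteq> seq.span B" by (auto simp: K_def)
  have "g \<in> K" using g orth by (auto simp: K_def)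
  then have "\<exists>\<nu> h. h \<in> K \<and> h \<notin> {z. null z} \<and> R h - seq_scale \<nu> h \<in> {z. null z}"
    using \<open>\<not> null g\<close>
    by (intro exists_eigenvector_mod_subspace[OF seq.vector_space_axioms R(1) K inv B(1) KB K0, of g]) auto
  then obtain \<nu> h where h: "h \<in> K" "\<not> null h" "null (R h - seq_scale \<nu> h)"
    by (simp only: mem_Collect_eq) blast
  have PR: "\<Psi> k *v R h k = \<nu> *s (\<Psi> k *v h k)" if "k \<le> N" for k
    using h(3) that by (simp add: null_def matrix_vector_mult_diff_distrib vector_scalar_commute)
  show False
  proof (cases "\<nu> = 0")
    case True
    then have null: "null (R h)" using PR by (simp add: null_def)
    obtain f where "bvp f h" using h by (auto simp: K_def)
    then have "ip f (R h) = ip h h + \<mu> * ip h (R h)"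
      using Lagrange_identity[OF \<open>bvp f h\<close> R(3)[of h]] by (simp add: psi_inner_linear)
    then have "ip h h = 0" by (simp add: inner_null[OF null])
    with h show False by (simp add: inner_self_eq_0_iff)
  next
    case False
    \<comment> \<open>The right-hand side enters only through \<open>\<Psi>\<close>, so
      \<open>h\<close> may be replaced by \<open>inverse \<nu>\<close> times \<open>R h\<close>,
      with which it agrees up to a null sequence.\<close>
    have "bvp (seq_scale (inverse \<nu> + \<mu>) (R h)) (R h)"
    proof (rule bvp_cong[OF R(3)[of h]])
      fix k assume "k \<le> N"
      then show "\<Psi> k *v (h + seq_scale \<mu> (R h)) k = \<Psi> k *v seq_scale (inverse \<nu> + \<mu>) (R h) k"
        using False by (simp add: matrix_vector_right_distrib vector_scalar_commute PR
            vector_smult_assoc algebra_simps vector_sadd_rdistrib)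
    qed
    then have "R h \<in> E (inverse \<nu> + \<mu>)" using R by (simp add: Eigen_iff)
    then have "ip (R h) (R h) = 0" using inv[OF h(1)] by (auto simp: K_def)
    then have "\<forall>k\<le>N. \<nu> *s (\<Psi> k *v h k) = 0"
      using PR by (auto simp: inner_self_eq_0_iff null_def)
    then show False using False h(2) by (simp add: null_def)
  qed
qed

section \<open>Expansion and Parseval's identity\<close>

lemma psi_norm_eq_0_iff: "psi_norm N \<Psi> z = 0 \<longleftrightarrow> null z"
  using inner_nonneg[of z] inner_self_eq_0_iff[of z]
  by (auto simp: psi_norm_def less_eq_complex_def complex_eq_iff)

lemma psi_norm_square: "of_real ((psi_norm N \<Psi> z)\<^sup>2) = ip z z"
  using inner_nonneg[of z] by (simp add: psi_norm_def less_eq_complex_def complex_eq_iff)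

text \<open>The coefficients make \<open>zh - w\<close> orthogonal to every basis member, hence to
  every eigenfunction. As \<open>zh - w\<close> also solves a boundary value problem,
  \<open>null_if_orthogonal\<close> applies.\<close>

lemma eigenfunction_expansion:
  fixes lam :: "nat \<Rightarrow> real"
  assumes zh: "zh \<in> seqs N" "bvp f zh"
    and lam: "strict_mono_on {1..p} lam" "(\<lambda>j. complex_of_real (lam j)) ` {1..p} = eigenvalues N S \<Psi> \<alpha> \<beta>"
    and z: "\<And>j. j \<in> {1..p} \<Longrightarrow> orthonormal_basis N \<Psi> (E (lam j)) (r j) (z j)"
    and c: "\<And>j l. j \<in> {1..p} \<Longrightarrow> l \<in> {1..r j} \<Longrightarrow> c j l = ip (z j l) zh"
    and w: "w = (\<Sum>j=1..p. \<Sum>l=1..r j. seq_scale (c j l) (z j l))"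
  shows "w \<in> seqs N" and "null (zh - w)"
    and "ip zh zh = (\<Sum>j=1..p. \<Sum>l=1..r j. of_real ((cmod (c j l))\<^sup>2))"
proof -
  have zE: "z j l \<in> E (lam j)" if "j \<in> {1..p}" "l \<in> {1..r j}" for j l
    using z[OF that(1)] that(2) seq.span_base[of "z j l" "z j ` {1..r j}"]
    by (auto simp: orthonormal_basis_def)
  have ortho: "ip (z j l) (z i m) = (if i = j \<and> m = l then 1 else 0)"
    if "j \<in> {1..p}" "l \<in> {1..r j}" "i \<in> {1..p}" "m \<in> {1..r i}" for i j l m
  proof (cases "i = j")
    case True
    then show ?thesis using z[OF that(1)] that by (auto simp: orthonormal_basis_def)
  next
    case False
    then have "lam i \<noteq> lam j"
      using strict_mono_on_imp_inj_on[OF lam(1)] that by (auto dest: inj_onD)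
    then show ?thesis using Eigen_orthogonal zE that False by (metis of_real_eq_iff)
  qed
  show w_seqs: "w \<in> seqs N"
    unfolding w using zE
    by (intro seq.subspace_sum[OF subspace_seqs] seq.subspace_scale[OF subspace_seqs]) (auto simp: Eigen_iff)
  have zw: "ip (z j l) w = c j l" if jl: "j \<in> {1..p}" "l \<in> {1..r j}" for j l
  proof -
    have "ip (z j l) w = (\<Sum>i=1..p. \<Sum>m=1..r i. c i m * ip (z j l) (z i m))"
      by (simp add: w psi_inner_sum_right psi_inner_linear)
    \<comment> \<open>The test on \<open>m\<close> stands outside so that the inner sum collapses
      first; its range depends on \<open>i\<close>.\<close>
    also have "\<dots> = (\<Sum>i=1..p. \<Sum>m=1..r i. if m = l then if i = j then c j l else 0 else 0)"
      using ortho[OF jl] by (intro sum.cong refl) auto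
    also have "\<dots> = (\<Sum>i=1..p. if i = j then c j l else 0)"
      using jl by (intro sum.cong refl) auto
    finally show ?thesis using jl by simp
  qed
  \<comment> \<open>Each eigenfunction lies in the domain of the relation, which is closed under
    linear combinations.\<close>
  have "\<exists>fw. bvp fw w"
  proof -
    have sum: "\<exists>f. bvp f (\<Sum>i\<in>I. h i)" if "\<And>i. i \<in> I \<Longrightarrow> \<exists>f. bvp f (h i)" for I :: "nat set" and h
      using that bvp_zero bvp_add by (induction I rule: infinite_finite_induct) (auto; blast)+
    show ?thesis unfolding w
      by (intro sum) (meson zE Eigen_iff bvp_scale)
  qed
  then obtain fw where "bvp fw w" ..
  then have bvp: "bvp (f - fw) (zh - w)" using zh bvp_diff by blast
  show null: "null (zh - w)"
  proof (rule null_if_orthogonal[OF _ bvp])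
    show "zh - w \<in> seqs N" using zh w_seqs seq.subspace_diff[OF subspace_seqs] by blast
    fix \<mu> e assume e: "e \<in> E \<mu>"
    show "ip e (zh - w) = 0"
    proof (cases "e = 0")
      case True
      then show ?thesis by (simp add: psi_inner_def)
    next
      case False
      then have "\<mu> \<in> eigenvalues N S \<Psi> \<alpha> \<beta>" using e by (auto simp: eigenvalues_def)
      then obtain j where j: "j \<in> {1..p}" "\<mu> = lam j" unfolding lam(2)[symmetric] by blast
      have "e \<in> seq.span (z j ` {1..r j})" using z[OF j(1)] e j by (simp add: orthonormal_basis_def)
      then show ?thesis
      proof (induction rule: seq.span_induct_alt)
        case base
        then show ?case by (simp add: psi_inner_def)
      next
        case (step a x y)
        then obtain l where "l \<in> {1..r j}" "x = z j l" by auto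
        then have "ip x (zh - w) = 0" using zw c j by (simp add: psi_inner_linear)
        then show ?case using step by (simp only: psi_inner_linear(4,6)) simp
      qed
    qed
  qed
  \<comment> \<open>The null sequence \<open>zh - w\<close> is orthogonal to everything; expanding
    \<open>w\<close> then pairs each \<open>c j l\<close> with its conjugate.\<close>
  have "ip zh zh = ip zh w"
    using inner_null[OF null, of zh] by (simp add: psi_inner_linear)
  also have "\<dots> = (\<Sum>j=1..p. \<Sum>l=1..r j. c j l * ip zh (z j l))"
    by (simp add: w psi_inner_sum_right psi_inner_linear)
  also have "\<dots> = (\<Sum>j=1..p. \<Sum>l=1..r j. of_real ((cmod (c j l))\<^sup>2))"
    using inner_commute[of zh] c by (intro sum.cong refl) (simp add: complex_norm_square del: of_real_power)
  finally show "ip zh zh = (\<Sum>j=1..p. \<Sum>l=1..r j. of_real ((cmod (c j l))\<^sup>2))" .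
qed

end

theorem theorem3p3:
  fixes N :: nat
    and S \<Psi> :: "nat \<Rightarrow> 'n::finite mat2"
    and \<alpha> \<beta> :: "complex ^ ('n + 'n) ^ 'n"
    and f zh :: "'n sequ"
  assumes "coefficients_ok N S \<Psi>"
    and "\<alpha> \<in> Gamma_bc" and "\<beta> \<in> Gamma_bc"
    and "weak_Atkinson N S \<Psi> \<alpha>"
    and "f \<in> seqs N"
    and "zh \<in> seqs N" and "solves_bvp N S \<Psi> \<alpha> \<beta> f zh"
  shows "finite (eigenvalues N S \<Psi> \<alpha> \<beta>) \<and> eigenvalues N S \<Psi> \<alpha> \<beta> \<subseteq> \<real> \<and>
    (\<forall>(p::nat) (lam :: nat \<Rightarrow> real) (r :: nat \<Rightarrow> nat) (z :: nat \<Rightarrow> nat \<Rightarrow> 'n sequ)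
        (c :: nat \<Rightarrow> nat \<Rightarrow> complex) (w :: 'n sequ).
      strict_mono_on {1..p} lam \<longrightarrow>
      (\<lambda>j. complex_of_real (lam j)) ` {1..p} = eigenvalues N S \<Psi> \<alpha> \<beta> \<longrightarrow>
      (\<forall>j\<in>{1..p}. r j = seq.dim (Eigen N S \<Psi> \<alpha> \<beta> (lam j)) \<and>
         orthonormal_basis N \<Psi> (Eigen N S \<Psi> \<alpha> \<beta> (lam j)) (r j) (z j)) \<longrightarrow>
      (\<forall>j\<in>{1..p}. \<forall>l\<in>{1..r j}. c j l = (\<Sum>k\<le>N. cdot (z j l k) (\<Psi> k *v zh k))) \<longrightarrow>
      w = (\<Sum>j=1..p. \<Sum>l=1..r j. seq_scale (c j l) (z j l)) \<longrightarrow>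
        psi_equiv N \<Psi> `` {zh} \<in> ell2 N \<Psi> \<and> w \<in> psi_equiv N \<Psi> `` {zh} \<and>
        psi_norm N \<Psi> (zh - w) = 0 \<and>
        (psi_norm N \<Psi> zh)\<^sup>2 = (\<Sum>j=1..p. \<Sum>l=1..r j. (cmod (c j l))\<^sup>2))"
proof -
  interpret symplectic_bvp N S \<Psi> \<alpha> \<beta> using assms(1-4) by unfold_locales
  have real: "eigenvalues N S \<Psi> \<alpha> \<beta> \<subseteq> \<real>"
    using eigenvalue_real by (auto simp: Reals_cnj_iff)
  show ?thesis
  proof (intro conjI finite_eigenvalues real allI impI)
    fix p :: nat and lam :: "nat \<Rightarrow> real" and r z c and w :: "'n sequ"
    assume lam: "strict_mono_on {1..p} lam"
        "(\<lambda>j. complex_of_real (lam j)) ` {1..p} = eigenvalues N S \<Psi> \<alpha> \<beta>"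
      and z: "\<forall>j\<in>{1..p}. r j = seq.dim (E (lam j)) \<and> orthonormal_basis N \<Psi> (E (lam j)) (r j) (z j)"
      and c: "\<forall>j\<in>{1..p}. \<forall>l\<in>{1..r j}. c j l = (\<Sum>k\<le>N. cdot (z j l k) (\<Psi> k *v zh k))"
      and w: "w = (\<Sum>j=1..p. \<Sum>l=1..r j. seq_scale (c j l) (z j l))"
    have z': "orthonormal_basis N \<Psi> (E (lam j)) (r j) (z j)" if "j \<in> {1..p}" for j
      using z that by blast
    have c': "c j l = ip (z j l) zh" if "j \<in> {1..p}" "l \<in> {1..r j}" for j l
      using c that by (simp add: psi_inner_def)
    note expansion = eigenfunction_expansion[OF assms(6,7) lam z' c' w]
    have w_seqs: "w \<in> seqs N" by (rule expansion(1))
    have null: "null (zh - w)" by (rule expansion(2))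
    have Parseval: "ip zh zh = (\<Sum>j=1..p. \<Sum>l=1..r j. of_real ((cmod (c j l))\<^sup>2))"
      by (rule expansion(3))
    show "psi_equiv N \<Psi> `` {zh} \<in> ell2 N \<Psi>"
      unfolding ell2_def using assms(6) by (rule quotientI)
    show norm: "psi_norm N \<Psi> (zh - w) = 0" using null by (simp add: psi_norm_eq_0_iff)
    show "w \<in> psi_equiv N \<Psi> `` {zh}"
      using norm w_seqs assms(6) by (simp add: psi_equiv_def)
    have "complex_of_real ((psi_norm N \<Psi> zh)\<^sup>2) = of_real (\<Sum>j=1..p. \<Sum>l=1..r j. (cmod (c j l))\<^sup>2)"
      unfolding psi_norm_square Parseval by simp
    then show "(psi_norm N \<Psi> zh)\<^sup>2 = (\<Sum>j=1..p. \<Sum>l=1..r j. (cmod (c j l))\<^sup>2)"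
      by (simp only: of_real_eq_iff)
  qed
qed

end
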